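(* Let $K\ge 2$, let $\lambda>0$ be the source update rate of a file, and let $c_1,\dots,c_K>0$ and $u_1,\dots,u_K>0$. The freshness of the file at the user in a $K$-cache parallel system with cache update rates $(c_1,c_2,c_3,\dots,c_K)$ and user update rates $(u_1,u_2,u_3,\dots,u_K)$ is smaller than its freshness in a $(K-1)$-cache parallel system with cache update rates $(c_1+c_2,c_3,\dots,c_K)$ and user update rates $(u_1+u_2,u_3,\dots,u_K)$.
   Context: For a parallel system of $m$ caches with source update rate $\lambda$, source-to-cache rates $c_1,\dots,c_m$ and cache-to-user rates $u_1,\dots,u_m$, let $T_s\sim\mathrm{Exp}(\lambda)$, $W_{c_k}\sim\mathrm{Exp}(c_k)$, $\bar W_{u_k}\sim\mathrm{Exp}(u_k)$ $(k=1,\dots,m)$ be independent. Here $T_s$ is the duration of a source update cycle, $W_{c_k}$ is the waiting time until cache $k$ gets the current version, and $\bar W_{u_k}$ is the subsequent waiting time until cache $k$ updates the user. With $X_k=W_{c_k}+\bar W_{u_k}$ and $W_u=\min\{T_s,X_1,\dots,X_m\}$, the freshness of the file at the user (long-run fraction of time the user has the version currently at the source) is $F_u=\frac{\mathbb{E}[T_s-W_u]}{\mathbb{E}[T_s]}=1-\lambda\,\mathbb{E}[W_u]$. *)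

theory Defs
  imports "HOL-Probability.Probability"
begin

text \<open>
  The independent waiting times of a system whose caches are numbered from 1:
  \<open>Source\<close> is the length of a source update cycle,
  \<open>To_Cache k\<close> the time until cache \<open>k\<close> obtains the current version,
  \<open>To_User k\<close> the subsequent time until cache \<open>k\<close> updates the user.
\<close>

datatype clock = Source | To_Cache nat | To_User nat

definition clocks :: "nat \<Rightarrow> clock set" where
  "clocks m = insert Source (To_Cache ` {1..m} \<union> To_User ` {1..m})"

primrec clock_rate :: "real \<Rightarrow> (nat \<Rightarrow> real) \<Rightarrow> (nat \<Rightarrow> real) \<Rightarrow> clock \<Rightarrow> real" where
  "clock_rate lam c u Source = lam"
| "clock_rate lam c u (To_Cache k) = c k"
| "clock_rate lam c u (To_User k) = u k"

locale parallel_system = prob_space M for M :: "'a measure" +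
  fixes m :: nat
    and lam :: real
    and c u :: "nat \<Rightarrow> real"
    and W :: "clock \<Rightarrow> 'a \<Rightarrow> real"
  assumes indep: "indep_vars (\<lambda>_. borel) W (clocks m)"
    and exponential: "j \<in> clocks m \<Longrightarrow>
      distributed M lborel (W j) (exponential_density (clock_rate lam c u j))"

definition user_wait :: "nat \<Rightarrow> (clock \<Rightarrow> 'a \<Rightarrow> real) \<Rightarrow> 'a \<Rightarrow> real" where
  "user_wait m W \<omega> =
     Min (insert (W Source \<omega>) ((\<lambda>k. W (To_Cache k) \<omega> + W (To_User k) \<omega>) ` {1..m}))"

text \<open>
  In each source update cycle, the user lacks the current version for a time \<open>user_wait\<close>
  (the whole cycle if no cache delivers before the next source update) and has it for the rest.
  Freshness, the long-run fraction of time in which the user has the current version, is the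
  ratio of the expected fresh time per cycle to the expected cycle length.
\<close>

definition freshness :: "'a measure \<Rightarrow> nat \<Rightarrow> (clock \<Rightarrow> 'a \<Rightarrow> real) \<Rightarrow> real" where
  "freshness M m W =
     (\<integral>\<omega>. W Source \<omega> - user_wait m W \<omega> \<partial>M) / (\<integral>\<omega>. W Source \<omega> \<partial>M)"

definition merge_first_two :: "(nat \<Rightarrow> real) \<Rightarrow> nat \<Rightarrow> real" where
  "merge_first_two r k = (if k = 1 then r 1 + r 2 else r (Suc k))"

lemma ex_parallel_system:
  assumes "lam > 0" "\<And>k. k \<in> {1..m} \<Longrightarrow> c k > 0" "\<And>k. k \<in> {1..m} \<Longrightarrow> u k > 0"
  shows "\<exists>(M :: (clock \<Rightarrow> real) measure) W. parallel_system M m lam c u W"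
proof -
  define D where "D j = density lborel
    (exponential_density (if j \<in> clocks m then clock_rate lam c u j else 1))" for j
  have pos: "(if j \<in> clocks m then clock_rate lam c u j else 1) > 0" for j
    using assms by (auto simp: clocks_def)
  have D: "prob_space (D j)" for j
    unfolding D_def by (rule prob_space_exponential_density[OF pos])
  have sets_D: "sets (D j) = sets borel" for j
    by (simp add: D_def)
  define P where "P = PiM (clocks m) D"
  define W :: "clock \<Rightarrow> (clock \<Rightarrow> real) \<Rightarrow> real" where "W j \<omega> = \<omega> j" for j \<omega>
  interpret product_prob_space D "clocks m"
    by (intro product_prob_spaceI D)
  have P: "prob_space P"
    unfolding P_def by (rule prob_space_PiM[OF D])
  have meas: "W j \<in> borel_measurable P" if "j \<in> clocks m" for j
    using measurable_component_singleton[OF that, of D]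
    unfolding W_def P_def measurable_cong_sets[OF refl sets_D] .
  have distr_W: "distr P borel (W j) = D j" if "j \<in> clocks m" for j
  proof -
    have "distr P borel (W j) = distr P (D j) (\<lambda>\<omega>. \<omega> j)"
      by (rule distr_cong) (simp_all add: sets_D W_def)
    then show ?thesis
      unfolding P_def using distr_PiM_component[OF D that] by simp
  qed
  have "prob_space.indep_vars P (\<lambda>_. borel) W (clocks m)"
  proof (subst prob_space.indep_vars_iff_distr_eq_PiM'[OF P])
    show "clocks m \<noteq> {}" by (simp add: clocks_def)
    show "W j \<in> borel_measurable P" if "j \<in> clocks m" for j by (rule meas[OF that])
    have "distr P (PiM (clocks m) (\<lambda>_. borel)) (\<lambda>\<omega>. \<lambda>j\<in>clocks m. W j \<omega>)
        = distr P P (\<lambda>\<omega>. \<omega>)"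
      by (rule distr_cong)
        (auto simp: P_def W_def space_PiM sets_D intro!: sets_PiM_cong restrict_PiE_iff extensional_restrict)
    also have "\<dots> = P" by (simp add: distr_id)
    also have "\<dots> = PiM (clocks m) (\<lambda>j. distr P borel (W j))"
      unfolding P_def by (intro PiM_cong refl) (simp add: distr_W flip: P_def)
    finally show "distr P (PiM (clocks m) (\<lambda>_. borel)) (\<lambda>\<omega>. \<lambda>j\<in>clocks m. W j \<omega>)
        = PiM (clocks m) (\<lambda>j. distr P borel (W j))" .
  qed
  moreover have "distributed P lborel (W j) (exponential_density (clock_rate lam c u j))"
    if "j \<in> clocks m" for j
    unfolding distributed_def
  proof (intro conjI)
    have "distr P lborel (W j) = distr P borel (W j)"
      by (rule distr_cong) simp_all
    then show "distr P lborel (W j) = density lborel (exponential_density (clock_rate lam c u j))"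
      using distr_W[OF that] that by (simp add: D_def)
  qed (use meas[OF that] in simp_all)
  ultimately have "parallel_system P m lam c u W"
    using P by (simp add: parallel_system_def parallel_system_axioms_def)
  then show ?thesis by blast
qed

end

theory Submission imports Defs begin

text \<open>
  By independence and Fubini, the freshness is \<open>1 - E (\<Prod>k. S\<^sub>k T)\<close>, where \<open>S\<^sub>k\<close> is the
  tail of the total delay \<open>W\<^sub>c\<^sub>k + W\<^sub>u\<^sub>k\<close> and \<open>T\<close> is exponential with rate \<open>lam\<close>. So it
  suffices that the tail of the merged delay lies strictly below the product of the tails of the
  two delays. The reason is that both systems obtain the first copy at rate
  \<open>c\<^sub>1 + c\<^sub>2\<close>, but from then on the merged cache delivers at rate \<open>u\<^sub>1 + u\<^sub>2\<close>, whereas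
  two separate caches reach that rate only when both are current.
\<close>

section \<open>Calculus of the delay tail of a single cache\<close>

text \<open>
  The probability that at time \<open>t\<close> the cache is current but has not yet delivered. As an
  integral, it needs no case distinction between \<open>c = u\<close> and \<open>c \<noteq> u\<close>.
\<close>
definition pending :: "real \<Rightarrow> real \<Rightarrow> real \<Rightarrow> real" where
  "pending c u t = c * exp (- u * t) * integral {0..t} (\<lambda>s. exp ((u - c) * s))"

text \<open>For \<open>t \<ge> 0\<close> this is the survival function of the hypoexponential law,
  split by whether the cache is still outdated (first summand) or already current (second).\<close>

definition hypoexp_tail :: "real \<Rightarrow> real \<Rightarrow> real \<Rightarrow> real" where
  "hypoexp_tail c u t = exp (- c * t) + pending c u t"

lemma DERIV_integral_exp:
  fixes a :: real
  assumes "0 \<le> t" "t \<le> b"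
  shows "((\<lambda>x. integral {0..x} (\<lambda>s. exp (a * s))) has_real_derivative exp (a * t)) (at t within {0..b})"
  using assms by (intro integral_has_real_derivative continuous_intros) auto

text \<open>Balance equation: the inflow is \<open>c\<close> times the outdated probability, the
  outflow \<open>u\<close> times the pending mass. The derivative is taken within
  \<open>{0..b}\<close> because at 0 the left derivative is 0 while the right one is
  \<open>c\<close>.\<close>

lemma DERIV_pending:
  assumes "0 \<le> t" "t \<le> b"
  shows "(pending c u has_real_derivative c * exp (- c * t) - u * pending c u t) (at t within {0..b})"
proof -
  have e: "exp (- u * t) * exp ((u - c) * t) = exp (- c * t)"
    by (simp flip: exp_add add: algebra_simps)
  have "(pending c u has_real_derivative c * (exp (- u * t) * exp ((u - c) * t)) - u * pending c u t)
    (at t within {0..b})"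
    unfolding pending_def[abs_def]
    by (rule derivative_eq_intros DERIV_integral_exp[OF assms] refl)+ (simp add: algebra_simps)
  then show ?thesis unfolding e .
qed

lemma pending_0 [simp]: "pending c u 0 = 0"
  by (simp add: pending_def)

lemma hypoexp_tail_0 [simp]: "hypoexp_tail c u 0 = 1"
  by (simp add: hypoexp_tail_def)

lemma pending_pos:
  assumes "0 < c" "0 < t"
  shows "0 < pending c u t"
proof -
  have "integral {0..t} (\<lambda>_. 0) < integral {0..t} (\<lambda>s. exp ((u - c) * s))"
    using assms by (intro integral_less_real continuous_intros) auto
  then show ?thesis using assms by (simp add: pending_def)
qed

lemma hypoexp_tail_pos:
  assumes "0 < c" "0 \<le> t"
  shows "0 < hypoexp_tail c u t"
  using pending_pos[of c t u] assms
  by (cases "t = 0") (auto simp: hypoexp_tail_def intro!: add_pos_pos)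

text \<open>The passage from outdated to pending cancels, so only deliveries lower the tail.\<close>

lemma DERIV_hypoexp_tail:
  assumes "0 \<le> t" "t \<le> b"
  shows "(hypoexp_tail c u has_real_derivative - u * pending c u t) (at t within {0..b})"
  unfolding hypoexp_tail_def[abs_def]
  by (rule derivative_eq_intros DERIV_pending[OF assms] refl)+ simp

lemma isCont_hypoexp_tail: "isCont (hypoexp_tail c u) t"
proof -
  define b where "b = \<bar>t\<bar> + 1"
  have "continuous_on {-b..0} (\<lambda>t. exp (- c * t))"
    by (intro continuous_intros)
  \<comment> \<open>For negative \<open>t\<close> the interval \<open>{0..t}\<close> is empty, so
    \<open>pending\<close> is 0.\<close>
  moreover have "exp (- c * t) = hypoexp_tail c u t" if "t \<in> {-b..0}" for t
    using that by (cases "t = 0") (auto simp: hypoexp_tail_def pending_def)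
  ultimately have "continuous_on {-b..0} (hypoexp_tail c u)"
    by (rule continuous_on_eq)
  moreover have "continuous_on {0..b} (hypoexp_tail c u)"
    using DERIV_hypoexp_tail[of _ b c u] by (intro DERIV_continuous_on) auto
  ultimately have "continuous_on ({-b..0} \<union> {0..b}) (hypoexp_tail c u)"
    by (intro continuous_on_closed_Un) auto
  moreover have "t \<in> interior ({-b..0} \<union> {0..b})"
    by (rule interiorI[of "{-b<..<b}"]) (auto simp: b_def)
  ultimately show ?thesis
    by (rule continuous_on_interior)
qed

lemma measurable_hypoexp_tail [measurable]: "hypoexp_tail c u \<in> borel_measurable borel"
  by (simp add: borel_measurable_continuous_onI continuous_at_imp_continuous_on isCont_hypoexp_tail)

section \<open>Two caches against the merged one\<close>

text \<open>
  With \<open>p\<^sub>i\<close> and \<open>q\<^sub>i\<close> the probabilities that cache \<open>i\<close> is still outdated, respectively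
  is current but has not yet delivered, the difference \<open>D\<close> of the two tails satisfies
  \<open>D' + (u\<^sub>1 + u\<^sub>2) D = u\<^sub>1 p\<^sub>1 q\<^sub>2 + u\<^sub>2 q\<^sub>1 p\<^sub>2 > 0\<close>: the right-hand side
  accounts for the delivery rate of the cache that is still outdated.
\<close>
lemma hypoexp_tail_merge_less:
  assumes pos: "0 < c1" "0 < c2" "0 < u1" "0 < u2" and t: "0 < t"
  shows "hypoexp_tail (c1 + c2) (u1 + u2) t < hypoexp_tail c1 u1 t * hypoexp_tail c2 u2 t"
proof -
  define D where "D t = hypoexp_tail c1 u1 t * hypoexp_tail c2 u2 t - hypoexp_tail (c1 + c2) (u1 + u2) t" for t
  \<comment> \<open>Integrating factor for the differential equation of \<open>D\<close>.\<close>
  define E where "E t = exp ((u1 + u2) * t) * D t" for t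
  define r where "r t = exp ((u1 + u2) * t) *
    (u1 * exp (- c1 * t) * pending c2 u2 t + u2 * pending c1 u1 t * exp (- c2 * t))" for t
  have dE: "(E has_real_derivative r x) (at x within {0..t})" if "0 \<le> x" "x \<le> t" for x
  proof -
    \<comment> \<open>The outdated probability of the merged cache is the product of the separate
      ones, so these terms cancel in \<open>D\<close>.\<close>
    have e: "exp (- (c1 + c2) * x) = exp (- c1 * x) * exp (- c2 * x)"
      by (simp flip: exp_add add: algebra_simps)
    show ?thesis
      unfolding E_def[abs_def] D_def r_def
      by (rule derivative_eq_intros DERIV_hypoexp_tail that refl)+
         (simp only: hypoexp_tail_def e, simp add: algebra_simps)
  qed
  have "E 0 < E t"
  \<comment> \<open>Since \<open>pending\<close> is 0 at 0, so is \<open>r\<close>; positivity is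
    therefore asked only inside the interval.\<close>
  proof (rule DERIV_pos_imp_increasing_open[OF t])
    show "\<exists>y. DERIV E x :> y \<and> 0 < y" if "0 < x" "x < t" for x
    proof (intro exI conjI)
      show "DERIV E x :> r x"
        using dE[of x] that by (simp add: at_within_Icc_at)
      show "0 < r x"
        unfolding r_def using pos that pending_pos[of c1 x u1] pending_pos[of c2 x u2]
        by (intro mult_pos_pos add_pos_pos) auto
    qed
    show "continuous_on {0..t} E"
      using dE by (intro DERIV_continuous_on) auto
  qed
  then show ?thesis
    by (simp add: E_def D_def zero_less_mult_iff)
qed

section \<open>Expectations and sums through tail probabilities\<close>

text \<open>Layer cake: \<open>ennreal (X x)\<close> is the length of \<open>{0..<X x}\<close>,
  which is empty for negative \<open>X x\<close>; then the order of integration is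
  exchanged.\<close>

lemma nn_integral_eq_tail:
  assumes "sigma_finite_measure M" and X [measurable]: "X \<in> borel_measurable M"
  shows "(\<integral>\<^sup>+x. ennreal (X x) \<partial>M) =
    (\<integral>\<^sup>+t. emeasure M {x \<in> space M. t < X x} * indicator {0..} t \<partial>lborel)"
proof -
  interpret sigma_finite_measure M by fact
  interpret pair_sigma_finite lborel M ..
  have "(\<integral>\<^sup>+x. ennreal (X x) \<partial>M) = (\<integral>\<^sup>+x. (\<integral>\<^sup>+t. indicator {0..<X x} t \<partial>lborel) \<partial>M)"
  proof (rule nn_integral_cong)
    fix x
    show "ennreal (X x) = (\<integral>\<^sup>+t. indicator {0..<X x} t \<partial>lborel)"
      by (cases "0 \<le> X x") (auto simp: ennreal_neg)
  qed
  also have "\<dots> = (\<integral>\<^sup>+x. (\<integral>\<^sup>+t. indicator {0..} t * indicator {..<X x} t \<partial>lborel) \<partial>M)"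
    by (intro nn_integral_cong) (auto split: split_indicator)
  also have "\<dots> = (\<integral>\<^sup>+t. (\<integral>\<^sup>+x. indicator {0..} t * indicator {..<X x} t \<partial>M) \<partial>lborel)"
    unfolding indicator_def lessThan_iff by (rule Fubini') measurable
  also have "\<dots> = (\<integral>\<^sup>+t. emeasure M {x \<in> space M. t < X x} * indicator {0..} t \<partial>lborel)"
  proof (rule nn_integral_cong)
    fix t
    have "(\<integral>\<^sup>+x. indicator {0..} t * indicator {..<X x} t \<partial>M) =
        (\<integral>\<^sup>+x. indicator {0..} t * indicator {x \<in> space M. t < X x} x \<partial>M)"
      by (intro nn_integral_cong) (auto split: split_indicator)
    also have "\<dots> = emeasure M {x \<in> space M. t < X x} * indicator {0..} t"
      by (subst nn_integral_cmult) (auto simp: mult.commute)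
    finally show "(\<integral>\<^sup>+x. indicator {0..} t * indicator {..<X x} t \<partial>M) =
      emeasure M {x \<in> space M. t < X x} * indicator {0..} t" .
  qed
  finally show ?thesis .
qed

text \<open>Condition on \<open>X\<close>. If \<open>X\<close> exceeds \<open>t\<close>, the cache
  is still outdated at time \<open>t\<close>; otherwise the convolution over \<open>{0..t}\<close>
  gives the pending mass.\<close>

lemma (in prob_space) prob_exponential_sum_gt:
  assumes pos: "0 < c" "0 < u" and t: "0 \<le> t"
    and X: "distributed M lborel X (exponential_density c)"
    and Y: "distributed M lborel Y (exponential_density u)"
    and indep: "indep_var borel X borel Y"
  shows "\<P>(x in M. t < X x + Y x) = hypoexp_tail c u t"
proof -
  have [measurable]: "X \<in> borel_measurable M" "Y \<in> borel_measurable M"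
    using X Y by (auto dest: distributed_measurable)
  let ?DX = "distr M borel X" and ?DY = "distr M borel Y"
  interpret DX: prob_space ?DX by (rule prob_space_distr) simp
  interpret DY: prob_space ?DY by (rule prob_space_distr) simp
  interpret P: pair_prob_space ?DX ?DY ..
  have dX: "?DX = density lborel (exponential_density c)"
    using distributed_distr_eq_density[OF X] by (simp cong: distr_cong)
  \<comment> \<open>Negative \<open>s\<close> arises below as \<open>t - x\<close> with
    \<open>x > t\<close>; then \<open>{y. s < y}\<close> contains \<open>{y. 0 < y}\<close>, which
    has mass 1.\<close>
  have tailY: "emeasure ?DY {y. s < y} = (if s < 0 then 1 else ennreal (exp (- u * s)))" for s
  proof -
    have eq: "emeasure ?DY {y. s < y} = \<P>(x in M. s < Y x)" for s
      by (auto simp: emeasure_distr emeasure_eq_measure intro!: arg_cong[where f=prob])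
    have nn: "emeasure ?DY {y. s < y} = exp (- u * s)" if "0 \<le> s" for s
      using exponential_distributedD_gt[OF Y that pos(2)] by (simp add: eq mult.commute)
    have "emeasure ?DY {y. s < y} = 1" if "s < 0"
    proof (rule antisym)
      have "emeasure ?DY {y. 0 < y} \<le> emeasure ?DY {y. s < y}"
        using that by (intro emeasure_mono) auto
      then show "1 \<le> emeasure ?DY {y. s < y}" by (simp add: nn)
    qed (rule DY.emeasure_le_1)
    then show ?thesis using nn by auto
  qed
  have A: "(\<integral>\<^sup>+x. ennreal (c * exp (- c * x) * exp (- u * (t - x))) * indicator {0..t} x \<partial>lborel)
      = ennreal (pending c u t)"
  proof (rule nn_integral_has_integral_lebesgue')
    have e: "c * exp (- c * x) * exp (- u * (t - x)) = c * exp (- u * t) * exp ((u - c) * x)" for x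
      by (simp flip: exp_add add: algebra_simps)
    show "((\<lambda>x. c * exp (- c * x) * exp (- u * (t - x))) has_integral pending c u t) {0..t}"
      unfolding pending_def e
      by (intro has_integral_mult_right integrable_integral integrable_continuous_real
        continuous_intros)
  qed (use pos in auto)
  have B: "(\<integral>\<^sup>+x. ennreal (exponential_density c x) * indicator {t<..} x \<partial>lborel) = ennreal (exp (- c * t))"
  proof -
    have "(\<integral>\<^sup>+x. ennreal (exponential_density c x) * indicator {t<..} x \<partial>lborel) = emeasure ?DX {t<..}"
      unfolding dX by (subst emeasure_density) auto
    also have "\<dots> = \<P>(x in M. t < X x)"
      by (auto simp: emeasure_distr emeasure_eq_measure intro!: arg_cong[where f=prob])
    finally show ?thesis
      using exponential_distributedD_gt[OF X t pos(1)] by (simp add: mult.commute)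
  qed
  define S :: "(real \<times> real) set" where "S = {z \<in> space (borel \<Otimes>\<^sub>M borel). t < fst z + snd z}"
  have S [measurable]: "S \<in> sets (borel \<Otimes>\<^sub>M borel)"
    unfolding S_def by measurable
  have "emeasure M {x \<in> space M. t < X x + Y x} =
      emeasure (distr M (borel \<Otimes>\<^sub>M borel) (\<lambda>x. (X x, Y x))) S"
    by (subst emeasure_distr[OF _ S])
       (auto simp: S_def space_pair_measure intro!: arg_cong[where f="emeasure M"])
  also have "\<dots> = emeasure (?DX \<Otimes>\<^sub>M ?DY) S"
    using indep by (simp add: indep_var_distribution_eq)
  also have "\<dots> = (\<integral>\<^sup>+x. emeasure ?DY (Pair x -` S) \<partial>?DX)"
    by (rule DY.emeasure_pair_measure_alt) (simp add: S cong: sets_pair_measure_cong)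
  also have "\<dots> = (\<integral>\<^sup>+x. emeasure ?DY {y. t - x < y} \<partial>?DX)"
    by (intro nn_integral_cong arg_cong[where f="emeasure ?DY"])
       (auto simp: S_def space_pair_measure)
  also have "\<dots> = (\<integral>\<^sup>+x. ennreal (exponential_density c x) * emeasure ?DY {y. t - x < y} \<partial>lborel)"
    unfolding dX tailY by (subst nn_integral_density) auto
  \<comment> \<open>The density vanishes for negative \<open>x\<close>, and for \<open>x > t\<close>
    the tail of \<open>Y\<close> is 1. This leaves the integrals of \<open>B\<close> and
    \<open>A\<close>.\<close>
  also have "\<dots> = (\<integral>\<^sup>+x. ennreal (exponential_density c x) * indicator {t<..} x +
      ennreal (c * exp (- c * x) * exp (- u * (t - x))) * indicator {0..t} x \<partial>lborel)"
    unfolding tailY using pos t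
    by (intro nn_integral_cong)
       (auto simp: exponential_density_def mult.commute simp flip: ennreal_mult split: split_indicator)
  also have "\<dots> = ennreal (exp (- c * t)) + ennreal (pending c u t)"
    unfolding A[symmetric] B[symmetric] by (rule nn_integral_add) auto
  also have "\<dots> = ennreal (hypoexp_tail c u t)"
    using pending_pos[of c t u] pos t
    by (cases "t = 0") (auto simp: hypoexp_tail_def simp flip: ennreal_plus)
  finally show ?thesis
    using hypoexp_tail_pos[OF pos(1) t, of u] by (simp add: emeasure_eq_measure)
qed

section \<open>Freshness of a parallel system\<close>

context parallel_system
begin

lemma mem_clocks [simp]:
  "Source \<in> clocks m" "To_Cache k \<in> clocks m \<longleftrightarrow> k \<in> {1..m}" "To_User k \<in> clocks m \<longleftrightarrow> k \<in> {1..m}"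
  by (auto simp: clocks_def)

lemma measurable_clock: "j \<in> clocks m \<Longrightarrow> W j \<in> borel_measurable M"
  using exponential[of j] by (auto dest: distributed_measurable)

lemma user_wait_gt_iff:
  "t < user_wait m W \<omega> \<longleftrightarrow> t < W Source \<omega> \<and> (\<forall>k\<in>{1..m}. t < W (To_Cache k) \<omega> + W (To_User k) \<omega>)"
  by (auto simp: user_wait_def)

lemma measurable_user_wait: "user_wait m W \<in> borel_measurable M"
proof (rule borel_measurableI_greater)
  fix t
  have [measurable]: "W Source \<in> borel_measurable M"
    "\<And>k. k \<in> {1..m} \<Longrightarrow> W (To_Cache k) \<in> borel_measurable M"
    "\<And>k. k \<in> {1..m} \<Longrightarrow> W (To_User k) \<in> borel_measurable M"
    by (auto intro!: measurable_clock)
  show "{x \<in> space M. t < user_wait m W x} \<in> sets M"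
    unfolding user_wait_gt_iff by measurable
qed

text \<open>A minimum exceeds \<open>t\<close> iff all its entries do, and these are independent
  because they depend on disjoint sets of clocks.\<close>

lemma prob_user_wait_gt:
  assumes lam: "0 < lam" and c: "\<And>k. k \<in> {1..m} \<Longrightarrow> 0 < c k" and u: "\<And>k. k \<in> {1..m} \<Longrightarrow> 0 < u k"
    and t: "0 \<le> t"
  shows "\<P>(\<omega> in M. t < user_wait m W \<omega>) = exp (- lam * t) * (\<Prod>k\<in>{1..m}. hypoexp_tail (c k) (u k) t)"
proof -
  \<comment> \<open>Block 0 holds the source clock and block \<open>k\<close> the two clocks of
    cache \<open>k\<close>, so one family over \<open>{0..m}\<close> covers the cycle length and all
    delays.\<close>
  define B where "B k = (if k = 0 then {Source} else {To_Cache k, To_User k})" for k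
  define Y where "Y k f = (if k = 0 then f Source else f (To_Cache k) + f (To_User k))" for k and f :: "clock \<Rightarrow> real"
  define X where "X k \<omega> = Y k (restrict (\<lambda>j. W j \<omega>) (B k))" for k \<omega>
  have X0: "X 0 = W Source"
    by (auto simp: X_def Y_def B_def)
  have Xk: "X k = (\<lambda>\<omega>. W (To_Cache k) \<omega> + W (To_User k) \<omega>)" if "k \<in> {1..m}" for k
    using that by (auto simp: X_def Y_def B_def)
  have "indep_vars (\<lambda>k. PiM (B k) (\<lambda>_. borel)) (\<lambda>k \<omega>. restrict (\<lambda>j. W j \<omega>) (B k)) {0..m}"
    by (rule indep_vars_restrict[OF indep])
       (auto simp: B_def disjoint_family_on_def)
  then have indX: "indep_vars (\<lambda>_. borel) X {0..m}"
    unfolding X_def[abs_def]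
    by (rule indep_vars_compose2)
       (auto simp: Y_def[abs_def] B_def intro!: borel_measurable_add measurable_component_singleton)
  have gtX: "\<P>(\<omega> in M. t < X k \<omega>) = hypoexp_tail (c k) (u k) t" if k: "k \<in> {1..m}" for k
    unfolding Xk[OF k]
  proof (rule prob_exponential_sum_gt[OF c[OF k] u[OF k] t])
    show "distributed M lborel (W (To_Cache k)) (exponential_density (c k))"
      "distributed M lborel (W (To_User k)) (exponential_density (u k))"
      using exponential[of "To_Cache k"] exponential[of "To_User k"] k by auto
    show "indep_var borel (W (To_Cache k)) borel (W (To_User k))"
      using indep_var_compose[OF indep_var_restrict[OF indep, of "{To_Cache k}" "{To_User k}"],
          of "\<lambda>f. f (To_Cache k)" borel "\<lambda>f. f (To_User k)" borel] k
      by (simp add: comp_def measurable_component_singleton)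
  qed
  have gt0: "\<P>(\<omega> in M. t < X 0 \<omega>) = exp (- lam * t)"
    using exponential_distributedD_gt[OF _ t lam, of "W Source"] exponential[of Source]
    by (simp add: X0 mult.commute)
  have "{\<omega> \<in> space M. t < user_wait m W \<omega>} = (\<Inter>k\<in>{0..m}. X k -` {t<..} \<inter> space M)"
  proof -
    have "{0..m} = insert 0 {1..m}" by auto
    then show ?thesis by (auto simp: user_wait_gt_iff X0 Xk)
  qed
  also have "prob \<dots> = (\<Prod>k\<in>{0..m}. prob (X k -` {t<..} \<inter> space M))"
    by (rule indep_varsD_finite[OF indX]) auto
  also have "\<dots> = (\<Prod>k\<in>{0..m}. \<P>(\<omega> in M. t < X k \<omega>))"
    by (intro prod.cong refl arg_cong[where f=prob]) auto
  also have "\<dots> = exp (- lam * t) * (\<Prod>k\<in>{1..m}. hypoexp_tail (c k) (u k) t)"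
    by (simp add: prod.atLeast_Suc_atMost gt0 gtX)
  finally show ?thesis .
qed

text \<open>By layer cake the expected wait is the integral of \<open>exp (- lam * t) * g t\<close>
  over \<open>t \<ge> 0\<close>, that is \<open>1 / lam\<close> times the integral of
  \<open>g\<close> under \<open>D\<close>. Since \<open>D\<close> depends only on
  \<open>lam\<close>, systems on different probability spaces become comparable.\<close>

lemma freshness_eq:
  assumes lam: "0 < lam" and c: "\<And>k. k \<in> {1..m} \<Longrightarrow> 0 < c k" and u: "\<And>k. k \<in> {1..m} \<Longrightarrow> 0 < u k"
  defines "D \<equiv> density lborel (exponential_density lam)"
  defines "g \<equiv> \<lambda>t. \<Prod>k\<in>{1..m}. hypoexp_tail (c k) (u k) t"
  shows "integrable D g" and "freshness M m W = 1 - (\<integral>t. g t \<partial>D)"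
proof -
  let ?T = "W Source" and ?V = "user_wait m W"
  have [measurable]: "?V \<in> borel_measurable M" by (rule measurable_user_wait)
  have [measurable]: "?T \<in> borel_measurable M" by (rule measurable_clock) simp
  have [measurable]: "g \<in> borel_measurable borel"
    unfolding g_def by measurable
  have distT: "distributed M lborel ?T (exponential_density lam)"
    using exponential[of Source] by simp
  have ET: "expectation ?T = 1 / lam"
    by (rule exponential_distributed_expectation[OF lam distT])
  \<comment> \<open>A non-integrable function has Bochner integral 0, but \<open>ET\<close> gives a
    positive value.\<close>
  have intT: "integrable M ?T"
    using ET lam not_integrable_integral_eq[of M ?T] by fastforce
  have gt: "\<P>(\<omega> in M. t < ?V \<omega>) = exp (- lam * t) * g t" if "0 \<le> t" for t
    unfolding g_def using prob_user_wait_gt[OF lam c u that] by simp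
  have V_le: "?V \<omega> \<le> ?T \<omega>" for \<omega>
    by (simp add: user_wait_def)
  \<comment> \<open>At \<open>t = 0\<close> every factor of the tail formula is 1. Hence
    \<open>0 < ?V \<le> ?T\<close> almost surely, which yields integrability.\<close>
  have "\<P>(\<omega> in M. 0 < ?V \<omega>) = 1"
    by (subst gt) (simp_all add: g_def)
  then have V_pos: "AE \<omega> in M. 0 < ?V \<omega>"
    by (subst (asm) prob_Collect_eq_1) auto
  have intV: "integrable M ?V"
    by (rule Bochner_Integration.integrable_bound[OF intT])
       (use V_pos in \<open>auto elim!: eventually_mono simp: abs_le_iff intro: order_trans[OF V_le]\<close>)
  have g_nonneg: "0 \<le> g t" if "0 \<le> t" for t
    unfolding g_def using that c by (intro prod_nonneg) (auto intro!: less_imp_le hypoexp_tail_pos)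
  have "ennreal (expectation ?V) = (\<integral>\<^sup>+\<omega>. ennreal (?V \<omega>) \<partial>M)"
    using V_pos by (intro nn_integral_eq_integral[symmetric] intV) (auto elim: eventually_mono)
  also have "\<dots> = (\<integral>\<^sup>+t. emeasure M {\<omega> \<in> space M. t < ?V \<omega>} * indicator {0..} t \<partial>lborel)"
    by (rule nn_integral_eq_tail) (simp_all add: sigma_finite_measure_axioms)
  also have "\<dots> = (\<integral>\<^sup>+t. ennreal (1 / lam) * (ennreal (exponential_density lam t) * ennreal (g t)) \<partial>lborel)"
    using lam g_nonneg
    by (intro nn_integral_cong)
       (auto simp: emeasure_eq_measure gt exponential_density_def mult.commute simp flip: ennreal_mult
         split: split_indicator)
  also have "\<dots> = ennreal (1 / lam) * (\<integral>\<^sup>+t. ennreal (g t) \<partial>D)"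
    unfolding D_def by (subst nn_integral_cmult, simp, subst nn_integral_density) auto
  finally have eq: "ennreal (expectation ?V) = ennreal (1 / lam) * (\<integral>\<^sup>+t. ennreal (g t) \<partial>D)" .
  have AE_g: "AE t in D. 0 \<le> g t"
    unfolding D_def by (subst AE_density) (auto simp: exponential_density_def g_nonneg)
  have mg: "g \<in> borel_measurable D"
    by (simp add: D_def)
  show intg: "integrable D g"
  proof (rule integrableI_nonneg[OF mg AE_g])
    \<comment> \<open>By \<open>eq\<close>, an infinite integral would make the finite
      \<open>expectation ?V\<close> infinite.\<close>
    show "(\<integral>\<^sup>+t. ennreal (g t) \<partial>D) < \<infinity>"
      using eq lam by (cases "\<integral>\<^sup>+t. ennreal (g t) \<partial>D") (auto simp: ennreal_mult_top)
  qed
  have "ennreal (expectation ?V) = ennreal (1 / lam * (\<integral>t. g t \<partial>D))"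
    using lam integral_nonneg_AE[OF AE_g]
    by (simp add: eq nn_integral_eq_integral[OF intg AE_g] flip: ennreal_mult)
  moreover have "0 \<le> expectation ?V"
    using V_pos by (intro integral_nonneg_AE) (auto elim: eventually_mono)
  ultimately have "expectation ?V = 1 / lam * (\<integral>t. g t \<partial>D)"
    using lam integral_nonneg_AE[OF AE_g] by (subst (asm) ennreal_inj) auto
  then show "freshness M m W = 1 - (\<integral>t. g t \<partial>D)"
    using lam by (simp add: freshness_def Bochner_Integration.integral_diff[OF intT intV] ET field_simps)
qed

end

section \<open>Comparison of the two systems\<close>

theorem lemma4:
  fixes K :: nat and lam :: real and c u :: "nat \<Rightarrow> real"
    and M :: "'a measure" and W :: "clock \<Rightarrow> 'a \<Rightarrow> real"
    and M' :: "'b measure" and W' :: "clock \<Rightarrow> 'b \<Rightarrow> real"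
  assumes "K \<ge> 2"
    and "lam > 0"
    and "\<And>k. k \<in> {1..K} \<Longrightarrow> c k > 0"
    and "\<And>k. k \<in> {1..K} \<Longrightarrow> u k > 0"
    and "parallel_system M K lam c u W"
    and "parallel_system M' (K - 1) lam (merge_first_two c) (merge_first_two u) W'"
  shows "freshness M K W < freshness M' (K - 1) W'"
proof -
  let ?c = "merge_first_two c" and ?u = "merge_first_two u"
  let ?g = "\<lambda>t. \<Prod>k\<in>{1..K}. hypoexp_tail (c k) (u k) t"
  let ?h = "\<lambda>t. \<Prod>k\<in>{1..K - 1}. hypoexp_tail (?c k) (?u k) t"
  let ?D = "density lborel (exponential_density lam)"
  have pos: "0 < c 1" "0 < c 2" "0 < u 1" "0 < u 2"
    using assms(1,3,4) by auto
  have c': "0 < ?c k" and u': "0 < ?u k" if "k \<in> {1..K - 1}" for k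
    using that pos assms(3,4)[of "Suc k"] by (auto simp: merge_first_two_def)
  interpret D: prob_space ?D
    by (rule prob_space_exponential_density) fact
  note g = parallel_system.freshness_eq[OF assms(5,2,3,4)]
  note h = parallel_system.freshness_eq[OF assms(6,2) c' u']
  have less: "?h t < ?g t" if "0 < t" for t
  proof -
    \<comment> \<open>The factors shared by both systems: caches \<open>3..K\<close> become
      \<open>2..K - 1\<close> after merging.\<close>
    let ?R = "\<Prod>k\<in>{3..K}. hypoexp_tail (c k) (u k) t"
    have "?R > 0"
      using assms(3) that by (intro prod_pos) (auto intro!: hypoexp_tail_pos)
    moreover have "?g t = hypoexp_tail (c 1) (u 1) t * hypoexp_tail (c 2) (u 2) t * ?R"
    proof -
      have "{1..K} = insert 1 (insert 2 {3..K})" using assms(1) by auto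
      then show ?thesis by simp
    qed
    moreover have "?h t = hypoexp_tail (c 1 + c 2) (u 1 + u 2) t * ?R"
    proof -
      have "{1..K - 1} = insert 1 {2..K - 1}" using assms(1) by auto
      moreover have "(\<Prod>k\<in>{2..K - 1}. hypoexp_tail (?c k) (?u k) t) = ?R"
        by (rule prod.reindex_bij_witness[where i="\<lambda>k. k - 1" and j=Suc])
           (auto simp: merge_first_two_def)
      ultimately show ?thesis by (simp add: merge_first_two_def)
    qed
    ultimately show ?thesis
      using hypoexp_tail_merge_less[OF pos that] by simp
  qed
  \<comment> \<open>At 0 both products equal 1, so the strict inequality fails there; that point is
    null, and negative times have density 0.\<close>
  have "AE t in lborel. t \<noteq> (0::real)"
    by (rule AE_lborel_singleton)
  then have "AE t in ?D. ?h t < ?g t"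
    by (subst AE_density)
       (auto elim!: eventually_mono intro!: less[simplified] simp: exponential_density_def not_less split: if_splits)
  then have "(\<integral>t. ?h t \<partial>?D) < (\<integral>t. ?g t \<partial>?D)"
    by (intro D.integral_less_AE_space g(1) h(1)) (use D.emeasure_space_1 in simp_all)
  then show ?thesis
    by (simp only: g(2) h(2))
qed

end
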